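(* There is an absolute constant $c>0$ such that for every integer $n\ge 2$, with $N=\sum_{k=1}^n 2^k$ and $\sigma^\star=(\lambda_1,\dots,\lambda_N)\in\mathbb{D}_*^N$ the sequence (depending on $n$) defined in the context, $$\prod_{i=1}^{N}|\lambda_i|\cdot \mathrm{cap}_{\mathcal{B}^0_{\infty,1}}(\sigma^\star)\ \ge\ c\,\frac{\log N}{\log\log N}.$$
   Context: $\mathbb{D}$ is the open unit disc in $\mathbb{C}$, $\mathbb{D}_*=\mathbb{D}\setminus\{0\}$, $\mathbb{T}$ is the unit circle with normalized Lebesgue measure. Besov space: $\mathcal{B}^0_{\infty,1}$ is the space of analytic functions $f$ on $\mathbb{D}$ with $\|f\|_{\mathcal{B}^0_{\infty,1}}=|f(0)|+\int_0^1\|f'_\rho\|_{L^\infty(\mathbb{T})}\,d\rho<\infty$, where $f'_\rho(\zeta)=f'(\rho\zeta)$, $\zeta\in\mathbb{T}$. Capacity: for a Banach space $X$ of analytic functions on $\mathbb{D}$ and a finite sequence $\sigma=(\lambda_1,\dots,\lambda_N)\in\mathbb{D}_*^N$, $\mathrm{cap}_X(\sigma)=\inf\{\|f\|_X: f\in X,\ f(0)=1,\ f|\sigma=0\}$, where $f|\sigma=0$ means that $f$ vanishes at every point of $\sigma$ with multiplicity at least the number of times that point occurs in $\sigma$. The sequence $\sigma^\star$: for an integer $n\ge2$ and $k=1,\dots,n$ put $r_k^{(n)}=(1-1/n)^{2^{-k}}$ and $\sigma_k=(r_k^{(n)}e^{2\pi i j/2^k})_{j=1}^{2^k}\in\mathbb{D}_*^{2^k}$.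 Put $N=\sum_{k=1}^n 2^k$ and let $\sigma^\star=(\lambda_1,\dots,\lambda_N)\in\mathbb{D}_*^N$ be the concatenation $(\sigma_1,\sigma_2,\dots,\sigma_n)$. *)

theory Defs
  imports "HOL-Probability.Probability"
begin

text \<open>
  Normalized Lebesgue measure on the unit circle. Its space is the circle itself rather than the
  whole plane, so that measurability of a function does not depend on its values off the circle.
\<close>

definition circle_measure :: "complex measure" where
  "circle_measure =
     distr (uniform_measure lborel {0..<2 * pi}) (restrict_space borel (sphere 0 1)) cis"

lemma prob_space_circle_measure: "prob_space circle_measure"
  unfolding circle_measure_def
proof (rule prob_space.prob_space_distr)
  show "prob_space (uniform_measure lborel {0..<2 * pi})"
    by (rule prob_space_uniform_measure) auto
  have "cis \<in> borel_measurable borel"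
    by (intro borel_measurable_continuous_onI continuous_intros)
  then show "cis \<in> measurable (uniform_measure lborel {0..<2 * pi})
      (restrict_space borel (sphere 0 1))"
    by (intro measurable_restrict_space2) auto
qed

definition Linf_circle :: "(complex \<Rightarrow> complex) \<Rightarrow> ennreal" where
  "Linf_circle g = esssup circle_measure (\<lambda>\<zeta>. ennreal (cmod (g \<zeta>)))"

text \<open>
  Analytic functions on the disc are represented by functions on the whole plane that are
  holomorphic on the disc. Everything below depends only on the values inside the disc.
\<close>

definition besov_norm :: "(complex \<Rightarrow> complex) \<Rightarrow> ennreal" where
  "besov_norm f = ennreal (cmod (f 0)) +
     (\<integral>\<^sup>+\<rho>\<in>{0<..<1}. Linf_circle (\<lambda>\<zeta>. deriv f (complex_of_real \<rho> * \<zeta>)) \<partial>lborel)"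

definition besov_space :: "(complex \<Rightarrow> complex) set" where
  "besov_space = {f. f holomorphic_on ball 0 1 \<and> besov_norm f < \<infinity>}"

definition vanishes_on :: "(complex \<Rightarrow> complex) \<Rightarrow> complex list \<Rightarrow> bool" where
  "vanishes_on f \<sigma> \<longleftrightarrow> (\<forall>a\<in>set \<sigma>. \<forall>m<count_list \<sigma> a. (deriv ^^ m) f a = 0)"

text \<open>
  The infimum is taken in the extended half-line, so that it is infinite if there is no
  admissible function.
\<close>

definition cap ::
  "(complex \<Rightarrow> complex) set \<Rightarrow> ((complex \<Rightarrow> complex) \<Rightarrow> ennreal) \<Rightarrow> complex list \<Rightarrow> ennreal"
  where "cap X nrm \<sigma> = (INF f\<in>{f \<in> X. f 0 = 1 \<and> vanishes_on f \<sigma>}. nrm f)"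

definition star_radius :: "nat \<Rightarrow> nat \<Rightarrow> real" where
  "star_radius n k = (1 - 1 / real n) powr (1 / 2 ^ k)"

definition sigma_level :: "nat \<Rightarrow> nat \<Rightarrow> complex list" where
  "sigma_level n k =
     map (\<lambda>j. complex_of_real (star_radius n k) * exp (2 * of_real pi * \<i> * of_nat j / 2 ^ k))
       [1..<2 ^ k + 1]"

definition sigma_star :: "nat \<Rightarrow> complex list" where
  "sigma_star n = concat (map (sigma_level n) [1..<n + 1])"

lemma length_sigma_star: "length (sigma_star n) = (\<Sum>k=1..n. 2 ^ k)"
proof -
  have "length (sigma_star n) = sum_list (map (\<lambda>k. 2 ^ k) [1..<n + 1])"
    by (simp add: sigma_star_def length_concat sigma_level_def comp_def del: upt_Suc)
  also have "\<dots> = (\<Sum>k=1..n. 2 ^ k)"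
    by (simp only: interv_sum_list_conv_sum_set_nat set_upt Suc_eq_plus1[symmetric]
        atLeastLessThanSuc_atLeastAtMost)
  finally show ?thesis .
qed

lemma sigma_star_subset_punctured_disc:
  assumes "n \<ge> 2"
  shows "set (sigma_star n) \<subseteq> ball 0 1 - {0}"
proof
  fix z assume "z \<in> set (sigma_star n)"
  then obtain k j :: nat where z: "z = complex_of_real (star_radius n k) *
      exp (2 * of_real pi * \<i> * of_nat j / 2 ^ k)"
    by (auto simp: sigma_star_def sigma_level_def simp del: upt_Suc)
  have e: "2 * of_real pi * \<i> * of_nat j / 2 ^ k = \<i> * complex_of_real (2 * pi * j / 2 ^ k)"
    by simp
  have base: "0 < 1 - 1 / real n" "1 - 1 / real n < 1"
    using assms by auto
  have "star_radius n k > 0"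
    using base by (simp add: star_radius_def)
  moreover have "star_radius n k < 1"
    using base powr_less_mono2[of "1 / 2 ^ k" "1 - 1 / real n" 1]
    by (simp add: star_radius_def)
  moreover have "cmod z = \<bar>star_radius n k\<bar>"
    unfolding z e norm_mult norm_exp_i_times by simp
  ultimately show "z \<in> ball 0 1 - {0}"
    by auto
qed

end

theory Submission
  imports Defs "HOL-Complex_Analysis.Cauchy_Integral_Formula"
begin

text \<open>
  Let \<open>f\<close> be admissible for the capacity, put \<open>B = besov_norm f\<close>, and let \<open>M_k(t)\<close> be the mean of
  \<open>f\<close> over the \<open>2^k\<close> points of modulus \<open>t\<close> whose arguments are those of the \<open>k\<close>-th level of the
  sequence. Taking this mean keeps only the Taylor coefficients whose index is a multiple of \<open>2^k\<close>,
  so \<open>M_k(t)\<close> is a power series in \<open>t^(2^k)\<close> with constant term \<open>f 0 = 1\<close>. All its coefficients are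
  at most \<open>B\<close> in modulus, because the Besov norm dominates the supremum norm (\<open>norm_le_besov_norm\<close>) and
  Cauchy's inequality applies. Hence \<open>M_k\<close> is close to 1 where \<open>t^(2^k) = 1/n\<close>, up to an error
  \<open>2 B / n\<close> (\<open>root_mean_near_center\<close>), whereas \<open>M_k = 0\<close> where \<open>t^(2^k) = 1 - 1/n\<close>, since this is
  the radius at which \<open>f\<close> vanishes on the \<open>k\<close>-th level.

  So \<open>f\<close> has to vary by about 1 in the mean along the radial segments of level \<open>k\<close> cut out by
  \<open>1/n \<le> t^(2^k) \<le> 1 - 1/n\<close>. A change along a segment is paid for by the integral of the derivative.
  A given radius \<open>t\<close> meets the segments of few levels only: the numbers \<open>t^(2^k)\<close> are successive
  squares, and starting at or below \<open>1 - 1/n\<close> they stay above \<open>1/n\<close>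
  for at most \<open>2 log 2 n\<close> squarings
  (\<open>card_levels_meeting_radius\<close>). Adding up the variations over all \<open>n\<close> levels therefore counts
  the Besov integral at most \<open>2 log 2 n + 1\<close> times (\<open>weighted_radial_increments_le\<close>), which gives
  \<open>n - 2 B \<le> (2 log 2 n + 1) B\<close>: the capacity is at least of order \<open>n / log n\<close>.

  Finally the product of the moduli is \<open>(1 - 1/n)^n\<close>, since every level contributes \<open>1 - 1/n\<close>; it is
  bounded below by a positive constant. As \<open>ln N\<close> is comparable to \<open>n\<close>, the quotient \<open>n / log n\<close> is
  comparable to \<open>ln N / ln (ln N)\<close>.
\<close>

section \<open>Pointwise control by the Besov norm\<close>

text \<open>
  For a continuous function the essential supremum is a true upper bound: a set of angles where it
  is exceeded would be open in \<open>(0, 2 * pi)\<close>, hence empty if it is a null set. The angle 0 is then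
  reached by passing to the closure.
\<close>
lemma Linf_circle_ge:
  assumes cont: "continuous_on (sphere 0 1) g" and \<zeta>: "cmod \<zeta> = 1"
  shows "ennreal (cmod (g \<zeta>)) \<le> Linf_circle g"
proof (rule ccontr)
  assume "\<not> ?thesis"
  hence lt: "Linf_circle g < ennreal (cmod (g \<zeta>))" by simp
  then obtain E where E: "E \<ge> 0" "Linf_circle g = ennreal E"
    by (metis ennreal_cases not_less_iff_gr_or_eq order_less_trans less_top top.not_eq_extremum)
  have lt': "E < cmod (g \<zeta>)"
    using lt E by (simp add: ennreal_less_iff)
  define h where "h = (\<lambda>\<theta>::real. cmod (g (cis \<theta>)))"
  have conth: "continuous_on UNIV h"
    unfolding h_def
    by (intro continuous_on_norm continuous_on_compose2[OF cont] continuous_intros) auto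
  define S where "S = {\<theta>. 0 < \<theta> \<and> \<theta> < 2 * pi \<and> E < h \<theta>}"
  have "S = {0<..<2*pi} \<inter> {\<theta>. E < h \<theta>}" by (auto simp: S_def)
  hence openS: "open S"
    using open_Collect_less[OF continuous_on_const conth] by (auto intro!: open_Int)
  have "cis \<in> borel_measurable borel"
    by (intro borel_measurable_continuous_onI continuous_intros)
  hence meas: "cis \<in> measurable (uniform_measure lborel {0..<2 * pi})
      (restrict_space borel (sphere 0 1))"
    by (intro measurable_restrict_space2) auto
  have "AE z in circle_measure. ennreal (cmod (g z)) \<le> ennreal E"
    using esssup_AE[where M = circle_measure and f = "\<lambda>\<zeta>. ennreal (cmod (g \<zeta>))"] E
    by (simp add: Linf_circle_def)
  hence "AE \<theta> in uniform_measure lborel {0..<2 * pi}. ennreal (cmod (g (cis \<theta>))) \<le> ennreal E"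
    unfolding circle_measure_def by (rule AE_distrD[OF meas])
  hence "AE \<theta> in lborel. \<theta> \<in> {0..<2*pi} \<longrightarrow> h \<theta> \<le> E"
    by (subst (asm) AE_uniform_measure) (use E in \<open>auto simp: h_def\<close>)
  hence "AE \<theta> in lborel. \<theta> \<notin> S"
    by eventually_elim (auto simp: S_def)
  hence "S \<in> null_sets lborel"
    using openS by (subst (asm) AE_iff_null_sets[symmetric]) auto
  hence "negligible S"
    using negligible_iff_null_sets null_sets_completionI by blast
  hence "S = {}"
    using open_not_negligible openS by blast
  hence le: "h \<theta> \<le> E" if "\<theta> \<in> {0<..<2*pi}" for \<theta>
    using that \<open>S = {}\<close> unfolding S_def by force
  have "closure {0<..<2*pi} \<subseteq> {\<theta>. h \<theta> \<le> E}"
    using le by (intro closure_minimal closed_Collect_le conth continuous_on_const) auto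
  hence le': "h \<theta> \<le> E" if "\<theta> \<in> {0..2*pi}" for \<theta>
    using that by (auto simp: closure_greaterThanLessThan)
  have "\<zeta> = cis (Arg2pi \<zeta>)"
    using \<zeta> complex_norm_eq_1_exp[of \<zeta>] by (simp add: cis_conv_exp)
  moreover have "Arg2pi \<zeta> \<in> {0..2*pi}"
    using Arg2pi_ge_0[of \<zeta>] Arg2pi_lt_2pi[of \<zeta>] by simp
  ultimately show False
    using le'[of "Arg2pi \<zeta>"] lt' unfolding h_def by simp
qed

lemma deriv_le_Linf_circle:
  assumes hol: "f holomorphic_on ball 0 1" and \<rho>: "0 \<le> \<rho>" "\<rho> < 1" and \<zeta>: "cmod \<zeta> = 1"
  shows "ennreal (cmod (deriv f (of_real \<rho> * \<zeta>))) \<le> Linf_circle (\<lambda>\<zeta>. deriv f (of_real \<rho> * \<zeta>))"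
proof (rule Linf_circle_ge[OF _ \<zeta>])
  have "continuous_on (ball 0 1) (deriv f)"
    by (intro holomorphic_on_imp_continuous_on holomorphic_deriv hol open_ball)
  thus "continuous_on (sphere 0 1) (\<lambda>\<zeta>. deriv f (of_real \<rho> * \<zeta>))"
    by (rule continuous_on_compose2) (use \<rho> in \<open>auto intro!: continuous_intros simp: norm_mult\<close>)
qed

lemma continuous_on_radial_deriv:
  assumes hol: "f holomorphic_on ball 0 1" and ab: "0 \<le> a" "b < 1" and \<zeta>: "cmod \<zeta> = 1"
  shows "continuous_on {a..b} (\<lambda>t. deriv f (of_real t * \<zeta>))"
proof -
  have "continuous_on (ball 0 1) (deriv f)"
    by (intro holomorphic_on_imp_continuous_on holomorphic_deriv hol open_ball)
  thus ?thesis
    by (rule continuous_on_compose2) (use ab \<zeta> in \<open>auto intro!: continuous_intros simp: norm_mult\<close>)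
qed

lemma radial_increment_le:
  assumes hol: "f holomorphic_on ball 0 1" and ab: "0 \<le> a" "a \<le> b" "b < 1" and \<zeta>: "cmod \<zeta> = 1"
  shows "ennreal (cmod (f (of_real b * \<zeta>) - f (of_real a * \<zeta>)))
           \<le> (\<integral>\<^sup>+t. ennreal (cmod (deriv f (of_real t * \<zeta>))) * indicator {a..b} t \<partial>lborel)"
proof -
  have cont: "continuous_on {a..b} (\<lambda>t. deriv f (of_real t * \<zeta>))"
    by (rule continuous_on_radial_deriv) fact+
  have "((\<lambda>t. deriv f (of_real t * \<zeta>) * \<zeta>) has_integral
          (f (of_real b * \<zeta>) - f (of_real a * \<zeta>))) {a..b}"
  proof (rule fundamental_theorem_of_calculus[OF ab(2)])
    fix t assume t: "t \<in> {a..b}"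
    have "(f has_field_derivative deriv f (of_real t * \<zeta>)) (at (of_real t * \<zeta>))"
      using hol t ab \<zeta> by (intro holomorphic_derivI[of f "ball 0 1"]) (auto simp: norm_mult)
    moreover have "((\<lambda>t. of_real t * \<zeta>) has_vector_derivative \<zeta>) (at t within {a..b})"
      by (auto intro!: derivative_eq_intros)
    ultimately show "((\<lambda>t. f (of_real t * \<zeta>)) has_vector_derivative deriv f (of_real t * \<zeta>) * \<zeta>)
            (at t within {a..b})"
      using field_vector_diff_chain_within[of "\<lambda>t. of_real t * \<zeta>" \<zeta> t "{a..b}" f
          "deriv f (of_real t * \<zeta>)"] has_field_derivative_at_within
      by (fastforce simp: comp_def mult.commute)
  qed
  hence int: "f (of_real b * \<zeta>) - f (of_real a * \<zeta>) = integral {a..b} (\<lambda>t. deriv f (of_real t * \<zeta>) * \<zeta>)"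
    and integrable: "(\<lambda>t. deriv f (of_real t * \<zeta>) * \<zeta>) integrable_on {a..b}"
    by (auto simp: has_integral_iff)
  have intn: "(\<lambda>t. cmod (deriv f (of_real t * \<zeta>))) integrable_on {a..b}"
    by (intro integrable_continuous_interval continuous_on_norm cont)
  have "cmod (f (of_real b * \<zeta>) - f (of_real a * \<zeta>)) \<le> integral {a..b} (\<lambda>t. cmod (deriv f (of_real t * \<zeta>)))"
    unfolding int using \<zeta>
    by (intro integral_norm_bound_integral integrable intn) (auto simp: norm_mult)
  also have "ennreal \<dots> = (\<integral>\<^sup>+t. ennreal (cmod (deriv f (of_real t * \<zeta>))) * indicator {a..b} t \<partial>lborel)"
    using intn by (intro nn_integral_has_integral_lebesgue'[symmetric]) (auto simp: has_integral_iff)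
  finally show ?thesis by (simp add: ennreal_leI)
qed

text \<open>
  Integrate the derivative along the radius from 0 to \<open>z\<close>. In particular functions of finite Besov
  norm are bounded.
\<close>
lemma norm_le_besov_norm:
  assumes hol: "f holomorphic_on ball 0 1" and z: "cmod z < 1"
  shows "ennreal (cmod (f z)) \<le> besov_norm f"
proof -
  obtain \<zeta> where \<zeta>: "cmod \<zeta> = 1" "z = of_real (cmod z) * \<zeta>"
  proof (cases "z = 0")
    case False
    thus ?thesis by (intro that[of "z / of_real (cmod z)"]) (auto simp: norm_divide)
  qed (use that[of 1] in auto)
  have "ennreal (cmod (f z - f 0)) \<le>
     (\<integral>\<^sup>+t. ennreal (cmod (deriv f (of_real t * \<zeta>))) * indicator {0..cmod z} t \<partial>lborel)"
    using radial_increment_le[OF hol, of 0 "cmod z" \<zeta>] z \<zeta> by simp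
  also have "\<dots> \<le> (\<integral>\<^sup>+\<rho>\<in>{0<..<1}. Linf_circle (\<lambda>\<zeta>. deriv f (complex_of_real \<rho> * \<zeta>)) \<partial>lborel)"
  proof (rule nn_integral_mono_AE)
    show "AE t in lborel. ennreal (cmod (deriv f (of_real t * \<zeta>))) * indicator {0..cmod z} t
            \<le> Linf_circle (\<lambda>\<zeta>. deriv f (complex_of_real t * \<zeta>)) * indicator {0<..<1} t"
      using AE_lborel_singleton[of "0::real"]
      by eventually_elim
        (use z in \<open>auto simp: indicator_def intro!: deriv_le_Linf_circle hol \<zeta>(1)\<close>)
  qed
  finally have inc: "ennreal (cmod (f z - f 0)) \<le> \<dots>" .
  have "cmod (f z) \<le> cmod (f 0) + cmod (f z - f 0)"
    using norm_triangle_sub by blast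
  hence "ennreal (cmod (f z)) \<le> ennreal (cmod (f 0)) + ennreal (cmod (f z - f 0))"
    by (metis ennreal_leI ennreal_plus norm_ge_zero)
  also have "\<dots> \<le> besov_norm f"
    unfolding besov_norm_def using inc by (intro add_left_mono)
  finally show ?thesis .
qed

section \<open>Means over roots of unity\<close>

text \<open>Cauchy's inequality on the circle of radius \<open>r\<close>, in the limit \<open>r \<rightarrow> 1\<close>.\<close>
lemma bounded_taylor_coeff_le:
  assumes hol: "f holomorphic_on ball 0 1" and bd: "\<And>z. cmod z < 1 \<Longrightarrow> cmod (f z) \<le> B"
  shows "cmod ((deriv ^^ m) f 0 / fact m) \<le> B"
proof -
  define c where "c = cmod ((deriv ^^ m) f 0 / fact m)"
  have le: "c * r ^ m \<le> B" if r: "0 < r" "r < 1" for r :: real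
  proof -
    have "cmod ((deriv ^^ m) f 0) \<le> fact m * B / r ^ m"
    proof (rule Cauchy_inequality)
      have sub: "cball 0 r \<subseteq> ball (0::complex) 1" using r by auto
      show "f holomorphic_on ball 0 r"
        using hol r by (elim holomorphic_on_subset) auto
      show "continuous_on (cball 0 r) f"
        using holomorphic_on_imp_continuous_on[OF hol] sub continuous_on_subset by blast
      show "cmod (f x) \<le> B" if "cmod (0 - x) = r" for x
        using that r by (intro bd) auto
    qed (use r in auto)
    thus ?thesis
      using r by (simp add: c_def norm_divide field_simps)
  qed
  have "((\<lambda>r. c * r ^ m) \<longlongrightarrow> c * 1 ^ m) (at_left 1)"
    by (intro tendsto_intros)
  moreover have "\<forall>\<^sub>F r in at_left (1::real). c * r ^ m \<le> B"
    using eventually_at_left_real[of 0 1] by (auto elim!: eventually_mono intro: le)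
  ultimately have "c * 1 ^ m \<le> B"
    by (rule tendsto_upperbound) auto
  thus ?thesis by (simp add: c_def)
qed

definition unit_root :: "nat \<Rightarrow> nat \<Rightarrow> complex" where
  "unit_root D j = exp (2 * of_real pi * \<i> * of_nat j / of_nat D)"

lemma norm_unit_root [simp]: "cmod (unit_root D j) = 1"
proof -
  have "unit_root D j = exp (\<i> * of_real (2 * pi * j / D))"
    by (simp add: unit_root_def mult_ac)
  thus ?thesis by (simp only: norm_exp_i_times)
qed

lemma sum_unit_root_power:
  assumes "D > 0"
  shows "(\<Sum>j=1..D. unit_root D j ^ l) = (if D dvd l then of_nat D else 0)"
proof -
  have eq: "unit_root D j ^ l = unit_root D l ^ j" for j
    by (simp add: unit_root_def mult_ac flip: exp_of_nat_mult)
  have one: "unit_root D l = 1 \<longleftrightarrow> D dvd l"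
    using complex_root_unity_eq_1[of D l] assms by (simp add: unit_root_def mult_ac)
  have pow: "unit_root D l ^ D = 1"
    using assms complex_root_unity[of D l] by (simp add: unit_root_def)
  show ?thesis
  proof (cases "D dvd l")
    case True
    thus ?thesis using one by (simp add: eq)
  next
    case False
    have "(\<Sum>j=1..D. unit_root D l ^ j) = (\<Sum>j<D. unit_root D l ^ Suc j)"
      by (rule sum.reindex_bij_witness[of _ Suc "\<lambda>j. j - 1"]) auto
    also have "\<dots> = unit_root D l * (\<Sum>j<D. unit_root D l ^ j)"
      by (simp add: sum_distrib_left)
    also have "\<dots> = 0"
      using False one pow by (simp add: geometric_sum)
    finally show ?thesis using False by (simp add: eq)
  qed
qed

text \<open>Orthogonality of the roots of unity leaves only the Taylor terms whose index is divisible by \<open>D\<close>.\<close>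
lemma root_mean_sums:
  assumes hol: "f holomorphic_on ball 0 1" and D: "D > 0" and \<rho>: "0 \<le> \<rho>" "\<rho> < 1"
  shows "(\<lambda>m. (deriv ^^ (D * m)) f 0 / fact (D * m) * of_real (\<rho> ^ D) ^ m)
           sums ((\<Sum>j=1..D. f (of_real \<rho> * unit_root D j)) / of_nat D)"
proof -
  define a where "a = (\<lambda>l. (deriv ^^ l) f 0 / fact l)"
  have "(\<lambda>l. a l * (of_real \<rho> * unit_root D j) ^ l) sums f (of_real \<rho> * unit_root D j)" for j
    using holomorphic_power_series[OF hol, of "of_real \<rho> * unit_root D j"] \<rho>
    by (simp add: a_def norm_mult)
  hence "(\<lambda>l. (\<Sum>j=1..D. a l * (of_real \<rho> * unit_root D j) ^ l) / of_nat D)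
           sums ((\<Sum>j=1..D. f (of_real \<rho> * unit_root D j)) / of_nat D)"
    by (intro sums_divide sums_sum)
  also have "(\<lambda>l. (\<Sum>j=1..D. a l * (of_real \<rho> * unit_root D j) ^ l) / of_nat D) =
             (\<lambda>l. if D dvd l then a l * of_real \<rho> ^ l else 0)"
  proof
    fix l
    have "(\<Sum>j=1..D. a l * (of_real \<rho> * unit_root D j) ^ l) =
            a l * of_real \<rho> ^ l * (\<Sum>j=1..D. unit_root D j ^ l)"
      by (simp add: sum_distrib_left power_mult_distrib mult_ac)
    thus "(\<Sum>j=1..D. a l * (of_real \<rho> * unit_root D j) ^ l) / of_nat D =
            (if D dvd l then a l * of_real \<rho> ^ l else 0)"
      using D by (simp only: sum_unit_root_power[OF D]) auto
  qed
  finally have *: "(\<lambda>l. if D dvd l then a l * of_real \<rho> ^ l else 0)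
                     sums ((\<Sum>j=1..D. f (of_real \<rho> * unit_root D j)) / of_nat D)" .
  have "strict_mono (\<lambda>m. D * m)"
    using D by (auto simp: strict_mono_def)
  from sums_mono_reindex[OF this, THEN iffD2, OF _ *] show ?thesis
    by (auto simp: a_def power_mult image_iff dvd_def)
qed

text \<open>
  The mean is a power series in \<open>\<rho> ^ D\<close> with constant term \<open>f 0\<close> and coefficients bounded by \<open>B\<close>;
  the right-hand side is the geometric series that dominates its other terms.
\<close>
lemma root_mean_near_center:
  assumes hol: "f holomorphic_on ball 0 1" and bd: "\<And>z. cmod z < 1 \<Longrightarrow> cmod (f z) \<le> B"
    and D: "D > 0" and \<rho>: "0 \<le> \<rho>" "\<rho> < 1"
  shows "cmod ((\<Sum>j=1..D. f (of_real \<rho> * unit_root D j)) / of_nat D - f 0)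
           \<le> B * \<rho> ^ D / (1 - \<rho> ^ D)"
proof -
  define a where "a = (\<lambda>m. (deriv ^^ (D * m)) f 0 / fact (D * m))"
  define x where "x = \<rho> ^ D"
  have x: "0 \<le> x" "x < 1"
    using \<rho> D by (auto simp: x_def power_less_one_iff)
  have aB: "cmod (a m) \<le> B" for m
    unfolding a_def by (rule bounded_taylor_coeff_le[OF hol bd])
  have "(\<lambda>m. a m * of_real x ^ m) sums ((\<Sum>j=1..D. f (of_real \<rho> * unit_root D j)) / of_nat D)"
    using root_mean_sums[OF hol D \<rho>] by (simp add: a_def x_def)
  hence s: "(\<lambda>m. a (Suc m) * of_real x ^ Suc m) sums
          ((\<Sum>j=1..D. f (of_real \<rho> * unit_root D j)) / of_nat D - f 0)"
    by (subst sums_Suc_iff) (simp add: a_def)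
  have g: "(\<lambda>m. B * x * x ^ m) sums (B * x * (1 / (1 - x)))"
    by (intro sums_mult geometric_sums) (use x in auto)
  have "cmod (\<Sum>m. a (Suc m) * of_real x ^ Suc m) \<le> (\<Sum>m. B * x * x ^ m)"
  proof (rule norm_suminf_le)
    fix m
    have "cmod (a (Suc m)) * x ^ Suc m \<le> B * x ^ Suc m"
      by (intro mult_right_mono aB) (use x in auto)
    thus "cmod (a (Suc m) * of_real x ^ Suc m) \<le> B * x * x ^ m"
      using x by (simp add: norm_mult norm_power mult_ac)
  qed (use g in \<open>auto simp: sums_iff\<close>)
  thus ?thesis
    using s g by (simp add: sums_iff x_def)
qed

section \<open>Variation along overlapping radial segments\<close>

text \<open>
  If \<open>p\<close> and \<open>q\<close> are the least and the greatest \<open>k\<close> counted, then raising \<open>t ^ 2 ^ p \<le> 1 - 1 / n\<close> to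
  the power \<open>2 ^ (q - p)\<close> must not lead below \<open>1 / n\<close>. Since \<open>1 - 1 / n \<le> exp (- 1 / n)\<close>, this forces
  \<open>2 ^ (q - p) \<le> n * ln n \<le> n\<^sup>2\<close>.
\<close>
lemma card_levels_meeting_radius:
  fixes n :: nat and t :: real
  assumes n: "n \<ge> 2"
  shows "real (card {k \<in> {1..n}. 1 / real n \<le> t ^ 2 ^ k \<and> t ^ 2 ^ k \<le> 1 - 1 / real n})
           \<le> 2 * log 2 (real n) + 1"
proof -
  define A where "A = {k \<in> {1..n}. 1 / real n \<le> t ^ 2 ^ k \<and> t ^ 2 ^ k \<le> 1 - 1 / real n}"
  have fin: "finite A" by (simp add: A_def)
  have log_nonneg: "log 2 (real n) \<ge> 0" using n by simp
  show ?thesis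
  proof (cases "A = {}")
    case False
    define p q where "p = Min A" and "q = Max A"
    have pq: "p \<in> A" "q \<in> A" "p \<le> q"
      using False fin by (auto simp: p_def q_def)
    define d where "d = q - p"
    have "1 / real n \<le> t ^ 2 ^ q" using pq by (auto simp: A_def)
    also have "t ^ 2 ^ q = (t ^ 2 ^ p) ^ 2 ^ d"
      using pq(3) by (simp add: d_def flip: power_mult power_add)
    also have "\<dots> \<le> exp (- 1 / real n) ^ 2 ^ d"
    proof (rule power_mono)
      have "t ^ 2 ^ p \<le> 1 - 1 / real n" using pq by (auto simp: A_def)
      also have "\<dots> \<le> exp (- 1 / real n)"
        using exp_ge_add_one_self[of "- 1 / real n"] by simp
      finally show "t ^ 2 ^ p \<le> exp (- 1 / real n)" .
      have "0 \<le> 1 / real n" by simp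
      also have "\<dots> \<le> t ^ 2 ^ p" using pq by (auto simp: A_def)
      finally show "0 \<le> t ^ 2 ^ p" .
    qed
    also have "\<dots> = exp (- (2 ^ d / real n))"
      by (simp flip: exp_of_nat_mult)
    finally have "ln (1 / real n) \<le> - (2 ^ d / real n)"
      using n ln_mono[of "1 / real n" "exp (- (2 ^ d / real n))"] by simp
    hence "2 ^ d \<le> real n * ln (real n)"
      using n by (simp add: ln_div field_simps)
    also have "\<dots> \<le> real n * real n"
      using n by (intro mult_left_mono) (auto intro: less_imp_le ln_less_self)
    finally have "log 2 (2 ^ d) \<le> log 2 (real n * real n)"
      using n by (intro log_mono) auto
    hence d: "real d \<le> 2 * log 2 (real n)"
      using n by (simp add: log_mult log_nat_power)
    have "A \<subseteq> {p..q}"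
      using fin by (auto simp: p_def q_def)
    hence "card A \<le> card {p..q}" by (intro card_mono) auto
    also have "\<dots> = d + 1" using pq by (simp add: d_def)
    finally show ?thesis using d unfolding A_def[symmetric] by simp
  next
    case True
    thus ?thesis using log_nonneg unfolding A_def[symmetric] by simp
  qed
qed


text \<open>
  At each radius the \<open>L\<^sup>\<infinity>\<close> norm in the Besov integral bounds the derivative in all directions at
  once, so that the cost of segments in different directions depends only on how heavily their
  ranges of radii overlap.
\<close>
lemma weighted_radial_increments_le:
  fixes a b w :: "'i \<Rightarrow> real"
  assumes hol: "f holomorphic_on ball 0 1" and fin: "finite I" and K: "K > 0"
    and ab: "\<And>i. i \<in> I \<Longrightarrow> 0 < a i \<and> a i \<le> b i \<and> b i < 1"
    and w: "\<And>i. i \<in> I \<Longrightarrow> 0 \<le> w i" and \<zeta>: "\<And>i. i \<in> I \<Longrightarrow> cmod (\<zeta> i) = 1"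
    and overlap: "\<And>t. 0 < t \<Longrightarrow> t < 1 \<Longrightarrow> (\<Sum>i\<in>I. w i * indicator {a i..b i} t) \<le> K"
  shows "ennreal (\<Sum>i\<in>I. w i * cmod (f (of_real (b i) * \<zeta> i) - f (of_real (a i) * \<zeta> i)))
           \<le> ennreal K * besov_norm f"
proof -
  define L where "L = (\<lambda>t. Linf_circle (\<lambda>\<zeta>. deriv f (complex_of_real t * \<zeta>)))"
  define g where "g = (\<lambda>i t. ennreal (cmod (deriv f (of_real t * \<zeta> i))) * indicator {a i..b i} t)"
  have meas: "g i \<in> borel_measurable lborel" if "i \<in> I" for i
  proof -
    have "continuous_on {a i..b i} (\<lambda>t. cmod (deriv f (of_real t * \<zeta> i)))"
      using ab[OF that] \<zeta>[OF that]
      by (intro continuous_on_norm continuous_on_radial_deriv hol) auto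
    hence "(\<lambda>t. indicator {a i..b i} t *\<^sub>R cmod (deriv f (of_real t * \<zeta> i))) \<in> borel_measurable borel"
      by (intro borel_measurable_continuous_on_indicator) auto
    hence "(\<lambda>t. ennreal (indicator {a i..b i} t *\<^sub>R cmod (deriv f (of_real t * \<zeta> i)))) \<in> borel_measurable borel"
      by measurable
    also have "(\<lambda>t. ennreal (indicator {a i..b i} t *\<^sub>R cmod (deriv f (of_real t * \<zeta> i)))) = g i"
      by (auto simp: g_def indicator_def)
    finally show ?thesis by simp
  qed
  have overlap': "(\<Sum>i\<in>I. ennreal (w i) * g i t) \<le> ennreal K * (L t * indicator {0<..<1} t)" for t
  proof (cases "0 < t \<and> t < 1")
    case True
    have "(\<Sum>i\<in>I. ennreal (w i) * g i t) \<le> (\<Sum>i\<in>I. ennreal (w i * indicator {a i..b i} t) * L t)"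
    proof (intro sum_mono)
      fix i assume i: "i \<in> I"
      show "ennreal (w i) * g i t \<le> ennreal (w i * indicator {a i..b i} t) * L t"
        using True deriv_le_Linf_circle[OF hol, of t "\<zeta> i"] \<zeta>[OF i]
        by (auto simp: g_def L_def indicator_def intro!: mult_left_mono)
    qed
    also have "\<dots> = ennreal (\<Sum>i\<in>I. w i * indicator {a i..b i} t) * L t"
      using w by (simp add: sum_distrib_right[symmetric] sum_ennreal)
    also have "\<dots> \<le> ennreal K * L t"
      using overlap True by (intro mult_right_mono ennreal_leI) auto
    finally show ?thesis using True by simp
  next
    case False
    have "g i t = 0" if "i \<in> I" for i
      using False ab[OF that] by (auto simp: g_def indicator_def)
    thus ?thesis by simp
  qed
  have "ennreal (\<Sum>i\<in>I. w i * cmod (f (of_real (b i) * \<zeta> i) - f (of_real (a i) * \<zeta> i)))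
     = (\<Sum>i\<in>I. ennreal (w i) * ennreal (cmod (f (of_real (b i) * \<zeta> i) - f (of_real (a i) * \<zeta> i))))"
    using w by (subst sum_ennreal[symmetric]) (auto simp: ennreal_mult intro!: sum.cong)
  also have "\<dots> \<le> (\<Sum>i\<in>I. ennreal (w i) * (\<integral>\<^sup>+t. g i t \<partial>lborel))"
    unfolding g_def
    by (intro sum_mono mult_left_mono radial_increment_le hol) (use ab \<zeta> in \<open>auto intro: less_imp_le\<close>)
  also have "\<dots> = (\<Sum>i\<in>I. (\<integral>\<^sup>+t. ennreal (w i) * g i t \<partial>lborel))"
    by (intro sum.cong refl nn_integral_cmult[symmetric] meas)
  also have "\<dots> = (\<integral>\<^sup>+t. (\<Sum>i\<in>I. ennreal (w i) * g i t) \<partial>lborel)"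
    by (intro nn_integral_sum[symmetric] borel_measurable_times_ennreal meas) auto
  \<comment> \<open>Dividing the measurable sum by \<open>K\<close>, rather than pulling \<open>K\<close> out of an integral of \<open>L\<close>,
      makes it unnecessary to establish the measurability of \<open>L\<close>.\<close>
  also have "\<dots> = ennreal K * (ennreal (1 / K) * (\<integral>\<^sup>+t. (\<Sum>i\<in>I. ennreal (w i) * g i t) \<partial>lborel))"
    using K by (simp add: mult.assoc[symmetric] ennreal_mult[symmetric])
  also have "ennreal (1 / K) * (\<integral>\<^sup>+t. (\<Sum>i\<in>I. ennreal (w i) * g i t) \<partial>lborel)
      = (\<integral>\<^sup>+t. ennreal (1 / K) * (\<Sum>i\<in>I. ennreal (w i) * g i t) \<partial>lborel)"
    by (intro nn_integral_cmult[symmetric] borel_measurable_sum borel_measurable_times_ennreal meas) auto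
  also have "\<dots> \<le> (\<integral>\<^sup>+t\<in>{0<..<1}. L t \<partial>lborel)"
  proof (rule nn_integral_mono)
    fix t :: real
    have "ennreal (1 / K) * (\<Sum>i\<in>I. ennreal (w i) * g i t)
            \<le> ennreal (1 / K) * (ennreal K * (L t * indicator {0<..<1} t))"
      by (intro mult_left_mono overlap') auto
    also have "\<dots> = L t * indicator {0<..<1} t"
      using K by (simp add: mult.assoc[symmetric] ennreal_mult[symmetric])
    finally show "ennreal (1 / K) * (\<Sum>i\<in>I. ennreal (w i) * g i t) \<le> L t * indicator {0<..<1} t" .
  qed
  also have "\<dots> \<le> besov_norm f"
    by (simp add: besov_norm_def L_def)
  finally show ?thesis by (simp add: mult_left_mono)
qed

section \<open>Functions vanishing on the sequence\<close>

lemma power_root_powr: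
  fixes x :: real
  assumes "x > 0" "D > 0"
  shows "(x powr (1 / real D)) ^ D = x"
  using assms by (simp add: powr_realpow[symmetric] powr_powr)

text \<open>
  The segments run from \<open>\<rho> k\<close> to the \<open>k\<close>-th radius of the sequence in the directions of the
  \<open>2 ^ k\<close>-th roots of unity. The weight \<open>1 / 2 ^ k\<close> makes their contributions add up to a mean over
  each level.
\<close>
lemma besov_norm_ge_of_vanishing:
  assumes hol: "f holomorphic_on ball 0 1" and f0: "f 0 = 1" and n: "n \<ge> 2"
    and zero: "\<And>k j. k \<in> {1..n} \<Longrightarrow> j \<in> {1..2 ^ k} \<Longrightarrow>
                 f (of_real (star_radius n k) * unit_root (2 ^ k) j) = 0"
    and B: "besov_norm f = ennreal B" "B \<ge> 0"
  shows "real n \<le> (2 * log 2 (real n) + 3) * B"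
proof -
  \<comment> \<open>The threshold \<open>1 / n\<close> is small enough for the errors of all \<open>n\<close> levels to add up to \<open>O(B)\<close>,
      and large enough for the overlap to stay logarithmic.\<close>
  define \<rho> where "\<rho> = (\<lambda>k::nat. (1 / real n) powr (1 / 2 ^ k))"
  define K where "K = 2 * log 2 (real n) + 1"
  define I where "I = Sigma {1..n} (\<lambda>k. {1..(2::nat) ^ k})"
  have "log 2 (real n) \<ge> 0" using n by simp
  hence K: "K > 0" by (simp add: K_def)
  have \<rho>_pow: "\<rho> k ^ 2 ^ k = 1 / real n" for k
    using power_root_powr[of "1 / real n" "2 ^ k"] n by (simp add: \<rho>_def)
  have r_pow: "star_radius n k ^ 2 ^ k = 1 - 1 / real n" for k
    using power_root_powr[of "1 - 1 / real n" "2 ^ k"] n by (simp add: star_radius_def)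
  have \<rho>_pos: "\<rho> k > 0" for k
    using n by (simp add: \<rho>_def)
  have \<rho>_le: "\<rho> k \<le> star_radius n k" for k
    unfolding \<rho>_def star_radius_def using n by (intro powr_mono2) (auto simp: field_simps)
  have r_lt: "star_radius n k < 1" for k
    using n powr_less_mono2[of "1 / 2 ^ k" "1 - 1 / real n" 1] by (simp add: star_radius_def)
  have bd: "cmod (f z) \<le> B" if "cmod z < 1" for z
    using norm_le_besov_norm[OF hol that] B by simp

  have overlap: "(\<Sum>(k, j)\<in>I. 1 / 2 ^ k * indicator {\<rho> k..star_radius n k} t) \<le> K"
    if t: "0 < t" "t < 1" for t
  proof -
    have "(\<Sum>(k, j)\<in>I. 1 / 2 ^ k * indicator {\<rho> k..star_radius n k} t) =
            (\<Sum>k=1..n. \<Sum>j=1..(2::nat)^k. 1 / (2::real) ^ k * indicator {\<rho> k..star_radius n k} t)"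
      unfolding I_def by (subst sum.Sigma) auto
    also have "\<dots> = (\<Sum>k=1..n. indicator {\<rho> k..star_radius n k} t)"
      by simp
    also have "\<dots> = real (card {k \<in> {1..n}. t \<in> {\<rho> k..star_radius n k}})"
      by (simp add: indicator_def of_bool_def sum.If_cases Int_def)
    also have "\<dots> \<le> real (card {k \<in> {1..n}. 1 / real n \<le> t ^ 2 ^ k \<and> t ^ 2 ^ k \<le> 1 - 1 / real n})"
    proof (intro of_nat_mono card_mono)
      show "{k \<in> {1..n}. t \<in> {\<rho> k..star_radius n k}} \<subseteq>
              {k \<in> {1..n}. 1 / real n \<le> t ^ 2 ^ k \<and> t ^ 2 ^ k \<le> 1 - 1 / real n}"
      proof safe
        fix k assume k: "t \<in> {\<rho> k..star_radius n k}"
        show "1 / real n \<le> t ^ 2 ^ k"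
          using power_mono[of "\<rho> k" t "2 ^ k"] k \<rho>_pos[of k] by (simp add: \<rho>_pow)
        show "t ^ 2 ^ k \<le> 1 - 1 / real n"
          using power_mono[of t "star_radius n k" "2 ^ k"] k t by (simp add: r_pow)
      qed
    qed auto
    also have "\<dots> \<le> K"
      unfolding K_def by (rule card_levels_meeting_radius[OF n])
    finally show ?thesis .
  qed

  have level: "1 - 2 * B / real n \<le>
      (\<Sum>j=1..2^k. 1 / 2 ^ k * cmod (f (of_real (star_radius n k) * unit_root (2 ^ k) j)
                                      - f (of_real (\<rho> k) * unit_root (2 ^ k) j)))"
    if k: "k \<in> {1..n}" for k
  proof -
    define M where "M = (\<Sum>j=1..2^k. f (of_real (\<rho> k) * unit_root (2 ^ k) j)) / of_nat (2 ^ k)"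
    have "cmod (M - 1) \<le> B * (1 / real n) / (1 - 1 / real n)"
      using root_mean_near_center[OF hol bd, of "2 ^ k" "\<rho> k"] \<rho>_pos[of k] \<rho>_le[of k] r_lt[of k]
      unfolding M_def \<rho>_pow f0 by simp
    also have "\<dots> \<le> 2 * B / real n"
      using n B mult_left_mono[of 2 "real n" B] by (simp add: field_simps)
    finally have "1 - 2 * B / real n \<le> cmod M"
      using norm_triangle_ineq2[of 1 "1 - M"] by (simp add: norm_minus_commute)
    also have "cmod M \<le> (\<Sum>j=1..2^k. cmod (f (of_real (\<rho> k) * unit_root (2 ^ k) j))) / 2 ^ k"
      unfolding M_def by (simp add: norm_divide norm_power divide_right_mono norm_sum)
    also have "\<dots> = (\<Sum>j=1..2^k. 1 / 2 ^ k * cmod (f (of_real (star_radius n k) * unit_root (2 ^ k) j)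
                                      - f (of_real (\<rho> k) * unit_root (2 ^ k) j)))"
      using zero[OF k] by (simp add: sum_divide_distrib)
    finally show ?thesis .
  qed

  have "real n - 2 * B = (\<Sum>k=1..n. 1 - 2 * B / real n)"
    using n by (simp add: field_simps)
  also have "\<dots> \<le> (\<Sum>k=1..n. \<Sum>j=1..2^k. 1 / 2 ^ k *
       cmod (f (of_real (star_radius n k) * unit_root (2 ^ k) j) - f (of_real (\<rho> k) * unit_root (2 ^ k) j)))"
    by (intro sum_mono level)
  also have "\<dots> = (\<Sum>i\<in>I. 1 / 2 ^ fst i * cmod (f (of_real (star_radius n (fst i)) * unit_root (2 ^ fst i) (snd i))
       - f (of_real (\<rho> (fst i)) * unit_root (2 ^ fst i) (snd i))))" (is "_ = ?S")
    unfolding I_def by (subst sum.Sigma) (auto simp: case_prod_unfold)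
  finally have *: "real n - 2 * B \<le> ?S" .
  have "ennreal ?S \<le> ennreal K * besov_norm f"
    by (rule weighted_radial_increments_le[OF hol _ K])
       (use \<rho>_pos \<rho>_le r_lt overlap in \<open>auto simp: I_def case_prod_unfold\<close>)
  also have "\<dots> = ennreal (K * B)"
    using B K by (simp add: ennreal_mult)
  finally have "?S \<le> K * B"
    using B K by simp
  with * show ?thesis
    by (simp add: K_def algebra_simps)
qed

section \<open>Asymptotics of the constants\<close>

lemma sigma_level_eq:
  "sigma_level n k = map (\<lambda>j. of_real (star_radius n k) * unit_root (2 ^ k) j) [1..<2 ^ k + 1]"
  by (simp add: sigma_level_def unit_root_def)

lemma prod_norm_sigma_star:
  assumes n: "n \<ge> 2"
  shows "(\<Prod>i<length (sigma_star n). cmod (sigma_star n ! i)) = (1 - 1 / real n) ^ n"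
proof -
  have level: "prod_list (map cmod (sigma_level n k)) = 1 - 1 / real n" for k
  proof -
    have "prod_list (map cmod (sigma_level n k)) = star_radius n k ^ 2 ^ k"
      by (simp add: sigma_level_eq comp_def norm_mult star_radius_def map_replicate_const prod_list_replicate del: upt_Suc)
    thus ?thesis
      using power_root_powr[of "1 - 1 / real n" "2 ^ k"] n by (simp add: star_radius_def)
  qed
  have concat: "prod_list (map cmod (concat xs)) = prod_list (map (\<lambda>x. prod_list (map cmod x)) xs)" for xs
    by (induction xs) auto
  have "(\<Prod>i<length (sigma_star n). cmod (sigma_star n ! i)) = prod_list (map cmod (sigma_star n))"
    by (subst prod.list_conv_set_nth) (auto simp: atLeast0LessThan)
  also have "\<dots> = (1 - 1 / real n) ^ n"
    unfolding sigma_star_def concat by (simp add: comp_def level map_replicate_const prod_list_replicate del: upt_Suc)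
  finally show ?thesis .
qed

lemma one_minus_inverse_power_ge:
  fixes n :: nat
  assumes n: "n \<ge> 2"
  shows "(1 - 1 / real n) ^ n \<ge> exp (- 2)"
proof -
  have "-2 \<le> - 1 - 2 / real n"
    using n by (simp add: field_simps)
  also have "\<dots> = real n * (- (1 / real n) - 2 * (1 / real n)\<^sup>2)"
    using n by (simp add: field_simps power2_eq_square)
  also have "\<dots> \<le> real n * ln (1 - 1 / real n)"
    using n by (intro mult_left_mono ln_one_minus_pos_lower_bound) (auto simp: field_simps)
  finally have "exp (- 2) \<le> exp (real n * ln (1 - 1 / real n))"
    by simp
  also have "\<dots> = (1 - 1 / real n) ^ n"
    using n by (simp add: exp_of_nat_mult)
  finally show ?thesis .
qed

text \<open>
  As \<open>2 ^ n \<le> N \<le> 2 ^ (n + 1)\<close>, \<open>ln N\<close> lies between \<open>n * ln 2\<close> and \<open>2 * n * ln 2\<close>. For the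
  denominator, the factor \<open>ln 2 < 1\<close> in \<open>ln (n * ln 2)\<close> has to be absorbed also for small \<open>n\<close>, which
  is done by \<open>n \<le> (n * ln 2) ^ 4\<close>; this costs a factor 4.
\<close>
lemma ln_div_ln_ln_level_sum_le:
  fixes n :: nat
  assumes n: "n \<ge> 2"
  defines "N \<equiv> (\<Sum>k=1..n. 2 ^ k :: nat)"
  shows "ln (real N) / ln (ln (real N)) \<le> 8 * real n / log 2 (real n)"
proof -
  have "N + 2 = 2 ^ (n + 1)"
    unfolding N_def by (induction n) auto
  hence N: "N = 2 * 2 ^ n - 2" by simp
  have "(2::nat) ^ 1 \<le> 2 ^ n" using n by (intro power_increasing) auto
  hence lo: "2 ^ n \<le> N" and hi: "N \<le> 2 ^ (n + 1)" unfolding N by auto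
  have pos: "N > 0" by (rule less_le_trans[OF _ lo]) simp
  have l2: "ln (2::real) \<ge> 2 / 3" using ln2_ge_two_thirds .
  have "real n * ln 2 = ln (2 ^ n)" by (simp add: ln_realpow)
  also have "\<dots> \<le> ln (real N)"
    using of_nat_mono[OF lo, where 'a = real] pos by (intro ln_mono) auto
  finally have low: "real n * ln 2 \<le> ln (real N)" .
  have "real N \<le> real (2 ^ (n + 1))" using hi by (rule of_nat_mono)
  hence "ln (real N) \<le> ln (2 ^ (n + 1))"
    using pos by (intro ln_mono) auto
  also have "\<dots> = (real n + 1) * ln 2" by (simp only: ln_realpow) simp
  also have "\<dots> \<le> 2 * real n * ln 2" using n by simp
  finally have up: "ln (real N) \<le> 2 * real n * ln 2" .
  \<comment> \<open>Here \<open>2 ^ 3 * (2 / 3) ^ 4 = 128 / 81\<close>, and \<open>2 / 3\<close> bounds \<open>ln 2\<close> from below.\<close>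
  have "real n = real n * 1" by simp
  also have "1 \<le> (2::real) ^ 3 * (2 / 3) ^ 4" by (simp add: power_divide)
  also have "\<dots> \<le> real n ^ 3 * ln 2 ^ 4"
    using n l2 by (intro mult_mono power_mono) auto
  also have "real n * (real n ^ 3 * ln 2 ^ 4) = (real n * ln 2) ^ 4"
    by (simp add: power_mult_distrib eval_nat_numeral)
  finally have "ln (real n) \<le> ln ((real n * ln 2) ^ 4)"
    using n by (intro ln_mono) auto
  also have "\<dots> = 4 * ln (real n * ln 2)"
    using n by (subst ln_realpow) auto
  also have "\<dots> \<le> 4 * ln (ln (real N))"
    using n low by (intro mult_left_mono ln_mono) auto
  finally have lnln: "ln (real n) / 4 \<le> ln (ln (real N))" by simp
  have "ln (real N) / ln (ln (real N)) \<le> (2 * real n * ln 2) / (ln (real n) / 4)"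
    using n up lnln by (intro frac_le) auto
  also have "\<dots> = 8 * real n / log 2 (real n)"
    by (simp add: log_def)
  finally show ?thesis .
qed

theorem theorem2:
  shows "\<exists>c::real. c > 0 \<and>
    (\<forall>n::nat. n \<ge> 2 \<longrightarrow>
      (let N = (\<Sum>k=1..n. 2 ^ k) :: nat in
        ennreal (\<Prod>i<N. cmod (sigma_star n ! i)) * cap besov_space besov_norm (sigma_star n)
          \<ge> ennreal (c * (ln (real N) / ln (ln (real N))))))"
proof (intro exI conjI allI impI)
  \<comment> \<open>The product is at least \<open>exp (- 2)\<close>, the capacity at least \<open>n / (5 * log 2 n)\<close>, and
      \<open>ln N / ln (ln N)\<close> at most \<open>8 * n / log 2 n\<close>.\<close>
  show "exp (- 2) / 40 > (0::real)" by simp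
  fix n :: nat assume n: "n \<ge> 2"
  define N where "N = (\<Sum>k=1..n. 2 ^ k :: nat)"
  have log1: "log 2 (real n) \<ge> 1" using n by simp
  have cap: "ennreal (real n / (5 * log 2 (real n))) \<le> cap besov_space besov_norm (sigma_star n)"
    unfolding cap_def
  proof (rule INF_greatest)
    fix f assume "f \<in> {f \<in> besov_space. f 0 = 1 \<and> vanishes_on f (sigma_star n)}"
    hence hol: "f holomorphic_on ball 0 1" and fin: "besov_norm f < \<infinity>" and f0: "f 0 = 1"
      and van: "vanishes_on f (sigma_star n)"
      by (auto simp: besov_space_def)
    obtain B where B: "besov_norm f = ennreal B" "B \<ge> 0"
      using fin by (cases "besov_norm f") auto
    have zero: "f z = 0" if "z \<in> set (sigma_star n)" for z
    proof -
      have "0 < count_list (sigma_star n) z"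
        using that count_list_0_iff[of "sigma_star n" z] by (intro neq0_conv[THEN iffD1]) auto
      hence "(deriv ^^ 0) f z = 0"
        using van that unfolding vanishes_on_def by blast
      thus ?thesis by simp
    qed
    have "real n \<le> (2 * log 2 (real n) + 3) * B"
    proof (rule besov_norm_ge_of_vanishing[OF hol f0 n _ B])
      fix k j :: nat assume "k \<in> {1..n}" "j \<in> {1..2 ^ k}"
      thus "f (of_real (star_radius n k) * unit_root (2 ^ k) j) = 0"
        by (intro zero) (fastforce simp: sigma_star_def sigma_level_eq less_Suc_eq_le simp del: upt_Suc)
    qed
    also have "\<dots> \<le> 5 * log 2 (real n) * B"
      using log1 B by (intro mult_right_mono) auto
    finally have "real n / (5 * log 2 (real n)) \<le> B"
      using log1 by (simp add: field_simps)
    thus "ennreal (real n / (5 * log 2 (real n))) \<le> besov_norm f"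
      unfolding B(1) by (rule ennreal_leI)
  qed
  have "exp (- 2) / 40 * (ln (real N) / ln (ln (real N))) \<le> exp (- 2) / 40 * (8 * real n / log 2 (real n))"
    unfolding N_def by (intro mult_left_mono ln_div_ln_ln_level_sum_le n) auto
  also have "\<dots> = exp (- 2) * (real n / (5 * log 2 (real n)))"
    by simp
  finally have "ennreal (exp (- 2) / 40 * (ln (real N) / ln (ln (real N))))
      \<le> ennreal (exp (- 2)) * ennreal (real n / (5 * log 2 (real n)))"
    using log1 by (subst ennreal_mult[symmetric]) (auto intro!: ennreal_leI)
  also have "\<dots> \<le> ennreal (\<Prod>i<N. cmod (sigma_star n ! i)) * cap besov_space besov_norm (sigma_star n)"
    using prod_norm_sigma_star[OF n] one_minus_inverse_power_ge[OF n]
    by (intro mult_mono cap ennreal_leI) (auto simp: N_def length_sigma_star)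
  finally show "let N = (\<Sum>k=1..n. 2 ^ k) :: nat in
        ennreal (\<Prod>i<N. cmod (sigma_star n ! i)) * cap besov_space besov_norm (sigma_star n)
          \<ge> ennreal (exp (- 2) / 40 * (ln (real N) / ln (ln (real N))))"
    by (simp add: N_def)
qed

end
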